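(* Let $\alpha>0$ be a constant, $m=\alpha n$, and let $H$ be an $m\times n$ random matrix with i.i.d. standard normal entries. Define $\hat{\mathbf{x}}_1=1$, $r_1=\|H_{:,1}\|_2^2$, and for $2\le k\le n$ recursively $$\hat{\mathbf{x}}_k=\operatorname*{argmax}_{\mathbf{x}_k\in\{-1,1\}}\left\|H_{:,1:k}\begin{bmatrix}\hat{\mathbf{x}}_{1:k-1}\\ \mathbf{x}_k\end{bmatrix}\right\|_2^2,\qquad r_k=\|H_{:,1:k}\hat{\mathbf{x}}_{1:k}\|_2^2 .$$ Then for every $2\le k\le n$, $$E r_k=E r_{k-1}+2\sqrt{\tfrac{2}{\pi}}\,E\sqrt{r_{k-1}}+m .$$ Moreover, assume that the $r_k$ concentrate around their means for $k$ proportional to $n$, in the sense that for every $c\in(0,1]$ and $k=\lceil cn\rceil$ one has $\lim_{n\to\infty}\big(\frac{E\sqrt{r_k}}{n}-\frac{\sqrt{E r_k}}{n}\big)=0$. Then $$\lim_{n\to\infty}\frac{E r_n}{n^2}=\lim_{n\to\infty}\frac{\phi_n}{n^2},$$ where $\phi_1=m$ and $\phi_k=\phi_{k-1}+2\sqrt{\frac{2}{\pi}}\sqrt{\phi_{k-1}}+m$ for $2\le k\le n$.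
   Context: $H_{:,1:k}$ denotes the submatrix of the first $k$ columns of $H$, $H_{:,k}$ its $k$-th column, and $\hat{\mathbf{x}}_{1:k}$ the vector of the first $k$ components of $\hat{\mathbf{x}}$. Ties in the argmax (a probability-zero event) are broken arbitrarily. The limit $n\to\infty$ is taken along $n$ for which $m=\alpha n$ is a positive integer, with $\alpha$ fixed; for each such $n$ the sequence $\phi_1,\dots,\phi_n$ is computed with the corresponding $m$. This is the greedy iterative algorithm for approximately maximizing $\|H\mathbf{x}\|_2^2$ over $\mathbf{x}\in\{-1,1\}^n$. *)

theory Defs
  imports "HOL-Probability.Probability"
begin

(* Vectors and matrices are functions on 1-based indices; only the entries with row index in
   {1..m} and column index in {1..n} are used. *)

definition partial_energy :: "nat \<Rightarrow> (nat \<Rightarrow> nat \<Rightarrow> real) \<Rightarrow> nat \<Rightarrow> (nat \<Rightarrow> real) \<Rightarrow> real" where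
  "partial_energy m A k x = (L2_set (\<lambda>i. \<Sum>j=1..k. A i j * x j) {1..m})\<^sup>2"

(* A relation rather than a function, so that ties in the argmax may be broken in any way. *)
definition greedy_signs :: "nat \<Rightarrow> nat \<Rightarrow> (nat \<Rightarrow> nat \<Rightarrow> real) \<Rightarrow> (nat \<Rightarrow> real) \<Rightarrow> bool" where
  "greedy_signs m n A x \<longleftrightarrow>
     x 1 = 1 \<and>
     (\<forall>k\<in>{2..n}. is_arg_max (\<lambda>s. partial_energy m A k (x(k := s))) (\<lambda>s. s \<in> {-1, 1}) (x k))"

definition std_gaussian_matrix ::
    "'a measure \<Rightarrow> nat \<Rightarrow> nat \<Rightarrow> (nat \<Rightarrow> nat \<Rightarrow> 'a \<Rightarrow> real) \<Rightarrow> bool" where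
  "std_gaussian_matrix M m n H \<longleftrightarrow>
     prob_space.indep_vars M (\<lambda>_. borel) (\<lambda>(i, j). H i j) ({1..m} \<times> {1..n}) \<and>
     (\<forall>i\<in>{1..m}. \<forall>j\<in>{1..n}. distributed M lborel (H i j) std_normal_density)"

(* As x 1 = 1 for greedy signs, the case k = 1 is the squared norm of the first column. *)
definition greedy_value ::
    "nat \<Rightarrow> (nat \<Rightarrow> nat \<Rightarrow> 'a \<Rightarrow> real) \<Rightarrow> (nat \<Rightarrow> 'a \<Rightarrow> real) \<Rightarrow> nat \<Rightarrow> 'a \<Rightarrow> real" where
  "greedy_value m H x k \<omega> = partial_energy m (\<lambda>i j. H i j \<omega>) k (\<lambda>j. x j \<omega>)"

(* The value at 0 is a dummy; the sequence starts at index 1. *)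
fun phi :: "nat \<Rightarrow> nat \<Rightarrow> real" where
  "phi m 0 = 0"
| "phi m (Suc 0) = real m"
| "phi m (Suc (Suc k)) = phi m (Suc k) + 2 * sqrt (2 / pi) * sqrt (phi m (Suc k)) + real m"

definition admissible :: "real \<Rightarrow> nat set" where
  "admissible \<alpha> = {n. \<exists>m::nat. 0 < m \<and> real m = \<alpha> * real n}"

(* Equals \<alpha> * n exactly when n is admissible; irrelevant otherwise. *)
definition num_rows :: "real \<Rightarrow> nat \<Rightarrow> nat" where
  "num_rows \<alpha> n = nat \<lfloor>\<alpha> * real n\<rfloor>"

(* n tends to infinity through admissible values. *)
definition admissible_at_top :: "real \<Rightarrow> nat filter" where
  "admissible_at_top \<alpha> = inf sequentially (principal (admissible \<alpha>))"

end

theory Submission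
  imports Defs "HOL-Real_Asymp.Real_Asymp"
begin

text \<open>
  Write \<open>v\<close> for the current vector of the greedy algorithm and \<open>h\<close> for the next column. Choosing
  the sign greedily changes the energy from \<open>|v|\<^sup>2\<close> to \<open>|v|\<^sup>2 + 2 |<v, h>| + |h|\<^sup>2\<close>. The vector
  \<open>v\<close> depends on earlier columns only, so it is independent of \<open>h\<close>; given \<open>v\<close>, the inner product
  is normal with standard deviation \<open>|v|\<close>, and its mean absolute value is \<open>sqrt (2 / pi) |v|\<close>.
  Taking expectations gives the recursion (\<open>greedy_energy_expectation_Suc\<close>). Since ties may be broken
  arbitrarily, this is first proved for the vector \<open>greedy_vec\<close> with a fixed tie rule, and
  \<open>greedy_corr_nonzero\<close> shows that ties almost surely do not occur.

  After division by \<open>n\<^sup>2\<close>, the sequence \<open>phi\<close> is the Euler scheme with step \<open>1 / n\<close> for the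
  differential equation \<open>f' = 2 c sqrt f + \<alpha>\<close>, \<open>f 0 = 0\<close>, with \<open>c = sqrt (2 / pi)\<close>. The expected
  energies satisfy the same scheme with \<open>sqrt\<close> of the expectation replaced by the expectation of the
  \<open>sqrt\<close>, which is smaller by Jensen's inequality. Both therefore converge to the value \<open>L\<close> of the
  solution at time 1. The right-hand side is not Lipschitz at 0, so instead of estimating the
  difference of two trajectories, the proof applies to each of them the function \<open>travel_time\<close>, the
  inverse of the solution. It increases in every step by nearly \<open>1 / n\<close>, and the accumulated
  deficit is controlled by a telescoping sum and the average of the Jensen gaps
  (\<open>perturbed_euler_bounds\<close>). The concentration hypothesis says that these gaps vanish pointwise in
  \<open>k / n\<close>; as they are bounded, dominated convergence makes their average vanish
  (\<open>ceiling_average_tendsto_0\<close>).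
\<close>

section \<open>Perturbed Euler schemes for a square-root differential equation\<close>

text \<open>The time that the solution of \<open>f' = 2 c sqrt f + a\<close> with \<open>f 0 = 0\<close> needs to reach the value
  \<open>u\<close>, that is, the integral of \<open>1 / (2 c sqrt v + a)\<close> over \<open>v\<close> from 0 to \<open>u\<close>.\<close>
definition travel_time :: "real \<Rightarrow> real \<Rightarrow> real \<Rightarrow> real" where
  "travel_time c a u = sqrt u / c - a / (2 * c\<^sup>2) * ln (1 + 2 * c * sqrt u / a)"

lemma travel_time_0 [simp]: "travel_time c a 0 = 0"
  by (simp add: travel_time_def)

context
  fixes c a :: real
  assumes c: "c > 0" and a: "a > 0"
begin

lemma continuous_travel_time: "continuous_on {0..} (travel_time c a)"
proof -
  have "1 + 2 * c * sqrt u / a \<noteq> 0" if "u \<ge> 0" for u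
    using that c a by (smt (verit) divide_nonneg_pos mult_nonneg_nonneg real_sqrt_ge_zero)
  then show ?thesis
    unfolding travel_time_def using c a by (auto intro!: continuous_intros)
qed

lemma travel_time_deriv:
  assumes "u > 0"
  shows "(travel_time c a has_real_derivative 1 / (2 * c * sqrt u + a)) (at u)"
proof -
  define y where "y = sqrt u"
  have y: "y > 0" using assms by (simp add: y_def)
  have pos: "1 + 2 * c * y / a > 0" using y c a by (simp add: add_pos_pos)
  have "(travel_time c a has_real_derivative
     (inverse y / 2) / c - a / (2 * c\<^sup>2) * ((2 * c * (inverse y / 2) / a) / (1 + 2 * c * y / a))) (at u)"
    unfolding travel_time_def y_def using assms c a pos[unfolded y_def]
    by (auto intro!: derivative_eq_intros simp: power2_eq_square power4_eq_xxxx)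
  also have "(inverse y / 2) / c - a / (2 * c\<^sup>2) * ((2 * c * (inverse y / 2) / a) / (1 + 2 * c * y / a))
     = 1 / (2 * c * y + a)"
  proof -
    have e: "1 + 2 * c * y / a = (2 * c * y + a) / a" using a by (simp add: field_simps)
    have "2 * c * y + a \<noteq> 0" using c a y by (smt (verit) mult_pos_pos)
    then show ?thesis unfolding e using c a y
      by (simp add: divide_simps power2_eq_square)
  qed
  finally show ?thesis by (simp add: y_def)
qed

text \<open>By the mean value theorem, as the derivative is decreasing. Differentiability is established away
  from 0 only, where \<open>sqrt\<close> is smooth; at the endpoint 0 continuity is enough.\<close>
lemma travel_time_diff:
  assumes "0 \<le> u" "u \<le> v"
  shows "(v - u) / (2 * c * sqrt v + a) \<le> travel_time c a v - travel_time c a u"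
    and "travel_time c a v - travel_time c a u \<le> (v - u) / (2 * c * sqrt u + a)"
proof -
  have "(v - u) / (2 * c * sqrt v + a) \<le> travel_time c a v - travel_time c a u \<and>
        travel_time c a v - travel_time c a u \<le> (v - u) / (2 * c * sqrt u + a)"
  proof (cases "u = v")
    case False
    then have "u < v" using assms by simp
    moreover have "continuous_on {u..v} (travel_time c a)"
      by (rule continuous_on_subset[OF continuous_travel_time]) (use assms in auto)
    moreover have "(travel_time c a) differentiable (at x)" if "u < x" "x < v" for x
      using travel_time_deriv[of x] that assms real_differentiable_def by force
    ultimately obtain l z where z: "u < z" "z < v" "DERIV (travel_time c a) z :> l"
        "travel_time c a v - travel_time c a u = (v - u) * l"
      using MVT[of u v "travel_time c a"] by blast
    have "l = 1 / (2 * c * sqrt z + a)"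
      using z assms travel_time_deriv[of z] DERIV_unique by force
    then have eq: "travel_time c a v - travel_time c a u = (v - u) / (2 * c * sqrt z + a)"
      using z by simp
    have "0 < 2 * c * sqrt u + a" "2 * c * sqrt u + a \<le> 2 * c * sqrt z + a"
         "2 * c * sqrt z + a \<le> 2 * c * sqrt v + a"
      using z assms c a by (auto simp: add_nonneg_pos)
    then show ?thesis unfolding eq using assms by (auto intro!: divide_left_mono)
  qed auto
  then show "(v - u) / (2 * c * sqrt v + a) \<le> travel_time c a v - travel_time c a u"
    and "travel_time c a v - travel_time c a u \<le> (v - u) / (2 * c * sqrt u + a)" by auto
qed

lemma travel_time_strict_mono:
  assumes "0 \<le> u" "u < v"
  shows "travel_time c a u < travel_time c a v"
proof -
  have "0 < (v - u) / (2 * c * sqrt v + a)"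
    using assms c a by (auto intro!: divide_pos_pos add_nonneg_pos)
  then show ?thesis using travel_time_diff(1)[of u v] assms by simp
qed

lemma travel_time_eq_1: "\<exists>L\<ge>0. travel_time c a L = 1"
proof -
  have "filterlim (travel_time c a) at_top at_top"
    unfolding travel_time_def using c a by real_asymp
  then have "eventually (\<lambda>u. travel_time c a u \<ge> 1 \<and> u \<ge> 0) at_top"
    by (intro eventually_conj eventually_ge_at_top) (simp add: filterlim_at_top)
  then obtain u where u: "travel_time c a u \<ge> 1" "u \<ge> 0"
    using eventually_happens by fastforce
  have "continuous_on {0..u} (travel_time c a)"
    by (rule continuous_on_subset[OF continuous_travel_time]) auto
  then obtain L where "0 \<le> L" "L \<le> u" "travel_time c a L = 1"
    using IVT'[of "travel_time c a" 0 1 u] u by auto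
  then show ?thesis by auto
qed

text \<open>One Euler step of size \<open>h\<close> raises the travel time by at most \<open>h\<close>, since the derivative is
  largest at the start of the step and \<open>s k \<le> sqrt (g k)\<close>. The loss below \<open>h\<close> is at most
  \<open>2 c h / a\<close> times \<open>sqrt (g (k + 1)) - s k\<close>, which splits into a telescoping increment of
  \<open>sqrt g\<close> and the perturbation \<open>sqrt (g k) - s k\<close>.\<close>
lemma perturbed_euler_bounds:
  fixes g s :: "nat \<Rightarrow> real"
  assumes h: "h \<ge> 0" and g0: "g 0 = 0"
    and step: "\<And>k. k < n \<Longrightarrow> g (Suc k) = g k + h * (2 * c * s k + a)"
    and s: "\<And>k. k < n \<Longrightarrow> 0 \<le> s k" "\<And>k. k < n \<Longrightarrow> s k \<le> sqrt (g k)"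
    and k: "k \<le> n"
  shows "0 \<le> g k \<and> travel_time c a (g k) \<le> h * real k \<and>
     h * real k - 2 * c / a * h * (sqrt (g k) + (\<Sum>j<k. sqrt (g j) - s j)) \<le> travel_time c a (g k)"
  using k
proof (induction k)
  case (Suc k)
  have g: "0 \<le> g k" and sk: "0 \<le> s k" "s k \<le> sqrt (g k)" using Suc s by auto
  have pos: "0 < 2 * c * s k + a" using sk c a by (simp add: add_nonneg_pos)
  have step': "g (Suc k) - g k = h * (2 * c * s k + a)" using step Suc by simp
  have le: "g k \<le> g (Suc k)" using step' h pos by (smt (verit) mult_nonneg_nonneg)
  have "travel_time c a (g (Suc k)) - travel_time c a (g k)
      \<le> h * (2 * c * s k + a) / (2 * c * sqrt (g k) + a)"
    using travel_time_diff(2)[OF g le] step' by simp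
  also have "\<dots> \<le> h"
  proof -
    have "2 * c * s k + a \<le> 2 * c * sqrt (g k) + a" using sk c by simp
    then have "(2 * c * s k + a) / (2 * c * sqrt (g k) + a) \<le> 1" using pos by simp
    then show ?thesis using mult_left_mono[OF _ h] by fastforce
  qed
  finally have up: "travel_time c a (g (Suc k)) \<le> travel_time c a (g k) + h" by simp
  let ?G = "sqrt (g (Suc k))"
  have sG: "s k \<le> ?G" using sk le real_sqrt_le_mono[OF le] by linarith
  have D: "2 * c * ?G + a \<ge> a" "2 * c * ?G + a > 0"
    using c a mult_nonneg_nonneg[of c ?G] order_trans[OF sk(1) sG] by linarith+
  have "h * (1 - 2 * c / a * (?G - s k)) \<le> h * ((2 * c * s k + a) / (2 * c * ?G + a))"
  proof (rule mult_left_mono[OF _ h])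
    have "(2 * c * s k + a) / (2 * c * ?G + a) = 1 - 2 * c * (?G - s k) / (2 * c * ?G + a)"
      using D by (simp add: field_simps)
    moreover have "2 * c * (?G - s k) / (2 * c * ?G + a) \<le> 2 * c * (?G - s k) / a"
      using D a c sG by (intro divide_left_mono) auto
    ultimately show "1 - 2 * c / a * (?G - s k) \<le> (2 * c * s k + a) / (2 * c * ?G + a)"
      by simp
  qed
  also have "\<dots> \<le> travel_time c a (g (Suc k)) - travel_time c a (g k)"
    using travel_time_diff(1)[OF g le] step' by simp
  finally have lo: "travel_time c a (g k) + h - 2 * c / a * h * (?G - s k) \<le> travel_time c a (g (Suc k))"
    by (simp add: algebra_simps)
  have prev: "h * real k - 2 * c / a * h * (sqrt (g k) + (\<Sum>j<k. sqrt (g j) - s j)) \<le> travel_time c a (g k)"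
    using Suc by simp
  then have "h * real (Suc k) - 2 * c / a * h * (?G + (\<Sum>j<Suc k. sqrt (g j) - s j))
      \<le> travel_time c a (g (Suc k))"
  proof -
    define K where "K = 2 * c / a * h"
    have "travel_time c a (g k) + h - K * (?G - s k) \<le> travel_time c a (g (Suc k))"
      and "h * real k - K * (sqrt (g k) + (\<Sum>j<k. sqrt (g j) - s j)) \<le> travel_time c a (g k)"
      using lo prev by (simp_all only: K_def)
    then show ?thesis unfolding K_def[symmetric] by (simp add: algebra_simps)
  qed
  then show ?case using up Suc g le by (simp add: algebra_simps)
qed (use g0 in simp)

text \<open>If the perturbations vanish on average, the travel time of \<open>g n n\<close> is squeezed towards 1, and
  strict monotonicity of the travel time carries this over to \<open>g n n\<close> itself.\<close>
lemma perturbed_euler_tendsto: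
  fixes g s :: "nat \<Rightarrow> nat \<Rightarrow> real"
  assumes F: "F \<le> sequentially"
    and L: "L \<ge> 0" "travel_time c a L = 1"
    and g0: "eventually (\<lambda>n. g n 0 = 0) F"
    and step: "eventually (\<lambda>n. \<forall>k<n. g n (Suc k) = g n k + 1 / real n * (2 * c * s n k + a)) F"
    and s: "eventually (\<lambda>n. \<forall>k<n. 0 \<le> s n k \<and> s n k \<le> sqrt (g n k)) F"
    and err: "((\<lambda>n. (\<Sum>k<n. sqrt (g n k) - s n k) / real n) \<longlongrightarrow> 0) F"
  shows "((\<lambda>n. g n n) \<longlongrightarrow> L) F"
proof -
  define E where "E n = (\<Sum>k<n. sqrt (g n k) - s n k) / real n" for n
  define T where "T = travel_time c a"
  have pos: "eventually (\<lambda>n. n > 0) F"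
    using F eventually_gt_at_top[of 0] by (auto simp: le_filter_def)
  have bounds: "eventually (\<lambda>n. 0 \<le> g n n \<and> g n n \<le> L \<and>
        1 - 2 * c / a * (sqrt L / real n + E n) \<le> T (g n n)) F"
    using pos g0 step s
  proof eventually_elim
    case (elim n)
    have *: "0 \<le> g n n" "T (g n n) \<le> 1"
      "1 - 2 * c / a * (1 / real n) * (sqrt (g n n) + (\<Sum>j<n. sqrt (g n j) - s n j)) \<le> T (g n n)"
      using perturbed_euler_bounds[of "1 / real n" "g n" n "s n" n] elim by (auto simp: T_def)
    have le: "g n n \<le> L"
      using travel_time_strict_mono[of L "g n n"] L * by (force simp: T_def)
    have "2 * c / a * (1 / real n) * (sqrt (g n n) + (\<Sum>j<n. sqrt (g n j) - s n j))
       \<le> 2 * c / a * (1 / real n) * (sqrt L + (\<Sum>j<n. sqrt (g n j) - s n j))"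
      using le c a by (intro mult_left_mono) auto
    also have "\<dots> = 2 * c / a * (sqrt L / real n + E n)"
      by (simp add: E_def field_simps add_divide_distrib)
    finally show ?case using * le by linarith
  qed
  have lim: "((\<lambda>n. 1 - 2 * c / a * (sqrt L / real n + E n)) \<longlongrightarrow> 1) F"
  proof -
    have "((\<lambda>n. sqrt L / real n) \<longlongrightarrow> 0) F"
      by (rule tendsto_mono[OF F]) (rule lim_const_over_n)
    then have "((\<lambda>n. 1 - 2 * c / a * (sqrt L / real n + E n)) \<longlongrightarrow> 1 - 2 * c / a * (0 + 0)) F"
      using err unfolding E_def by (intro tendsto_intros)
    then show ?thesis by simp
  qed
  show ?thesis
  proof (rule order_tendstoI)
    fix y assume "L < y"
    with bounds show "eventually (\<lambda>n. g n n < y) F" by (auto elim: eventually_mono)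
  next
    fix y assume y: "y < L"
    show "eventually (\<lambda>n. y < g n n) F"
    proof (cases "y < 0")
      case True
      with bounds show ?thesis by (auto elim: eventually_mono)
    next
      case False
      then have "T y < 1" using travel_time_strict_mono[of y L] y L by (simp add: T_def)
      from order_tendstoD(1)[OF lim this] bounds show ?thesis
      proof eventually_elim
        case (elim n)
        show ?case
        proof (rule ccontr)
          assume "\<not> y < g n n"
          then have "T (g n n) \<le> T y"
            using travel_time_strict_mono[of "g n n" y] elim by (force simp: T_def le_less)
          with elim show False by simp
        qed
      qed
    qed
  qed
qed

end

section \<open>Averages along a restricted sequence\<close>

lemma tendsto_restrict_sequentially:
  fixes f :: "nat \<Rightarrow> real"
  shows "(f \<longlongrightarrow> 0) (inf sequentially (principal A)) \<longleftrightarrow> (\<lambda>n. if n \<in> A then f n else 0) \<longlonglongrightarrow> 0"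
proof -
  have "(f \<longlongrightarrow> 0) (inf sequentially (principal A)) \<longleftrightarrow>
     (\<forall>e>0. eventually (\<lambda>n. n \<in> A \<longrightarrow> \<bar>f n\<bar> < e) sequentially)"
    by (simp add: tendsto_iff eventually_inf_principal)
  also have "\<dots> \<longleftrightarrow> (\<lambda>n. if n \<in> A then f n else 0) \<longlonglongrightarrow> 0"
    unfolding tendsto_iff
    by (intro all_cong1 imp_cong refl arg_cong[where f = "\<lambda>P. eventually P sequentially"] ext)
       (auto simp: dist_real_def)
  finally show ?thesis .
qed

text \<open>The average of \<open>\<delta> n\<close> is the integral over \<open>c \<in> (0, 1]\<close> of the step function taking the value
  \<open>\<delta> n \<lceil>c n\<rceil>\<close>. These functions converge to 0 pointwise and are bounded, so dominated convergence
  applies. Outside \<open>A\<close> the step functions are set to 0, which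
  turns the limit along \<open>A\<close> into a limit of a full sequence.\<close>
lemma ceiling_average_tendsto_0:
  fixes \<delta> :: "nat \<Rightarrow> nat \<Rightarrow> real"
  assumes B: "B \<ge> 0"
    and bound: "\<And>n k. n \<in> A \<Longrightarrow> k \<in> {1..n} \<Longrightarrow> \<bar>\<delta> n k\<bar> \<le> B"
    and lim: "\<And>c. 0 < c \<Longrightarrow> c \<le> 1 \<Longrightarrow>
      ((\<lambda>n. \<delta> n (nat \<lceil>c * real n\<rceil>)) \<longlongrightarrow> 0) (inf sequentially (principal A))"
  shows "((\<lambda>n. (\<Sum>k=1..n. \<delta> n k) / real n) \<longlongrightarrow> 0) (inf sequentially (principal A))"
proof -
  define f where "f n c = (if n \<in> A then \<Sum>k=1..n. \<delta> n k * indicator {(real k - 1) / real n<..real k / real n} c else 0)"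
    for n and c :: real
  have f_eq: "f n c = (if n \<in> A \<and> 0 < c \<and> c \<le> 1 then \<delta> n (nat \<lceil>c * real n\<rceil>) else 0)"
    if n: "n > 0" for n c
  proof -
    have iff: "c \<in> {(real k - 1) / real n<..real k / real n} \<longleftrightarrow> 0 < c \<and> k = nat \<lceil>c * real n\<rceil>"
      if k: "k \<ge> 1" for k
    proof -
      have "c \<in> {(real k - 1) / real n<..real k / real n} \<longleftrightarrow> real k - 1 < c * real n \<and> c * real n \<le> real k"
        using n by (simp add: field_simps)
      also have "\<dots> \<longleftrightarrow> \<lceil>c * real n\<rceil> = int k"
        by (simp add: ceiling_eq_iff)
      also have "\<dots> \<longleftrightarrow> 0 < c \<and> k = nat \<lceil>c * real n\<rceil>"
      proof safe
        assume e: "\<lceil>c * real n\<rceil> = int k"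
        then have "\<lceil>c * real n\<rceil> > 0" using k by simp
        then show "0 < c" using n by (simp add: zero_less_mult_iff)
        show "k = nat \<lceil>c * real n\<rceil>" using e by simp
      qed (use k n in auto)
      finally show ?thesis .
    qed
    have rng: "nat \<lceil>c * real n\<rceil> \<in> {1..n} \<longleftrightarrow> c \<le> 1" if "0 < c"
    proof -
      have "0 < c * real n" using that n by simp
      then have "1 \<le> nat \<lceil>c * real n\<rceil>"
        by (metis One_nat_def Suc_leI zero_less_ceiling zero_less_nat_eq)
      moreover have "nat \<lceil>c * real n\<rceil> \<le> n \<longleftrightarrow> c * real n \<le> real n"
        by (simp add: nat_le_iff ceiling_le_iff)
      ultimately show ?thesis using n by simp
    qed
    have "(\<Sum>k=1..n. \<delta> n k * indicator {(real k - 1) / real n<..real k / real n} c)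
        = (\<Sum>k=1..n. if k = nat \<lceil>c * real n\<rceil> then (if 0 < c then \<delta> n k else 0) else 0)"
    proof (intro sum.cong refl)
      fix k assume "k \<in> {1..n}"
      then show "\<delta> n k * indicator {(real k - 1) / real n<..real k / real n} c
          = (if k = nat \<lceil>c * real n\<rceil> then (if 0 < c then \<delta> n k else 0) else 0)"
        using iff[of k] by (cases "c \<in> {(real k - 1) / real n<..real k / real n}") auto
    qed
    also have "\<dots> = (if 0 < c \<and> c \<le> 1 then \<delta> n (nat \<lceil>c * real n\<rceil>) else 0)"
      using rng by (auto simp: sum.delta)
    finally show ?thesis by (simp add: f_def)
  qed
  have "(\<lambda>n. \<integral>c. f n c \<partial>lborel) \<longlonglongrightarrow> (\<integral>c. 0 \<partial>(lborel :: real measure))"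
  proof (rule integral_dominated_convergence[where w = "\<lambda>c. B * indicator {0<..1} c"])
    show "f n \<in> borel_measurable lborel" for n unfolding f_def by measurable
    show "AE c in lborel. (\<lambda>n. f n c) \<longlonglongrightarrow> 0"
    proof (rule AE_I2)
      fix c :: real
      have "(\<lambda>n. if n \<in> A \<and> 0 < c \<and> c \<le> 1 then \<delta> n (nat \<lceil>c * real n\<rceil>) else 0) \<longlonglongrightarrow> 0"
        using lim[of c] by (cases "0 < c \<and> c \<le> 1") (auto simp: tendsto_restrict_sequentially)
      moreover have "eventually (\<lambda>n. f n c = (if n \<in> A \<and> 0 < c \<and> c \<le> 1 then \<delta> n (nat \<lceil>c * real n\<rceil>) else 0)) sequentially"
        using eventually_gt_at_top[of 0] by eventually_elim (rule f_eq)
      ultimately show "(\<lambda>n. f n c) \<longlonglongrightarrow> 0" by (simp add: tendsto_cong)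
    qed
    show "AE c in lborel. norm (f n c) \<le> B * indicator {0<..1} c" for n
    proof (rule AE_I2)
      fix c :: real
      show "norm (f n c) \<le> B * indicator {0<..1} c"
      proof (cases "n \<in> A \<and> n > 0 \<and> 0 < c \<and> c \<le> 1")
        case True
        then have "0 < c * real n" by simp
        then have "1 \<le> nat \<lceil>c * real n\<rceil>"
          by (metis One_nat_def Suc_leI zero_less_ceiling zero_less_nat_eq)
        moreover have "nat \<lceil>c * real n\<rceil> \<le> n"
          using True by (simp add: nat_le_iff ceiling_le_iff)
        ultimately show ?thesis using True bound[of n "nat \<lceil>c * real n\<rceil>"] by (simp add: f_eq)
      next
        case False
        then have "f n c = 0" using f_eq[of n c] by (cases "n = 0") (auto simp: f_def[of 0])
        then show ?thesis using B by simp
      qed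
    qed
  qed auto
  then have int: "(\<lambda>n. \<integral>c. f n c \<partial>lborel) \<longlonglongrightarrow> 0" by simp
  have "(\<integral>c. f n c \<partial>lborel) = (if n \<in> A then (\<Sum>k=1..n. \<delta> n k) / real n else 0)" for n
  proof (cases "n \<in> A")
    case True
    have "(\<integral>c. f n c \<partial>lborel) = (\<Sum>k=1..n. \<integral>c. \<delta> n k * indicator {(real k - 1) / real n<..real k / real n} c \<partial>lborel)"
      unfolding f_def if_P[OF True]
      by (intro Bochner_Integration.integral_sum integrable_mult_right) (auto simp: divide_right_mono)
    also have "\<dots> = (\<Sum>k=1..n. \<delta> n k / real n)"
    proof (intro sum.cong refl)
      fix k
      have "measure lborel {(real k - 1) / real n<..real k / real n} = real k / real n - (real k - 1) / real n"
        by (intro measure_lborel_Ioc divide_right_mono) auto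
      also have "\<dots> = 1 / real n" by (simp flip: diff_divide_distrib)
      finally show "(\<integral>c. \<delta> n k * indicator {(real k - 1) / real n<..real k / real n} c \<partial>lborel) = \<delta> n k / real n"
        by simp
    qed
    also have "\<dots> = (\<Sum>k=1..n. \<delta> n k) / real n"
      by (simp add: sum_divide_distrib)
    finally show ?thesis using True by simp
  qed (simp add: f_def)
  with int show ?thesis by (simp add: tendsto_restrict_sequentially del: One_nat_def)
qed

section \<open>Probabilistic preliminaries\<close>

text \<open>Conditioning on \<open>X\<close>: the joint law of independent variables is the product of their laws, so
  one may average over an independent copy of \<open>Y\<close> first.\<close>
lemma (in prob_space) nn_integral_indep_var:
  assumes ind: "indep_var S X T Y" and f [measurable]: "f \<in> borel_measurable (S \<Otimes>\<^sub>M T)"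
  shows "(\<integral>\<^sup>+\<omega>. f (X \<omega>, Y \<omega>) \<partial>M) = (\<integral>\<^sup>+\<omega>. (\<integral>\<^sup>+\<omega>'. f (X \<omega>, Y \<omega>') \<partial>M) \<partial>M)"
proof -
  have [measurable]: "random_variable S X" "random_variable T Y"
    and eq: "distr M S X \<Otimes>\<^sub>M distr M T Y = distr M (S \<Otimes>\<^sub>M T) (\<lambda>x. (X x, Y x))"
    using ind by (simp_all add: indep_var_distribution_eq)
  interpret Y: prob_space "distr M T Y" by (rule prob_space_distr) measurable
  have "(\<integral>\<^sup>+\<omega>. f (X \<omega>, Y \<omega>) \<partial>M) = (\<integral>\<^sup>+p. f p \<partial>distr M (S \<Otimes>\<^sub>M T) (\<lambda>x. (X x, Y x)))"
    by (simp add: nn_integral_distr)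
  also have "\<dots> = (\<integral>\<^sup>+x. \<integral>\<^sup>+y. f (x, y) \<partial>distr M T Y \<partial>distr M S X)"
    unfolding eq[symmetric] by (rule Y.nn_integral_fst[symmetric]) simp
  also have "\<dots> = (\<integral>\<^sup>+\<omega>. (\<integral>\<^sup>+y. f (X \<omega>, y) \<partial>distr M T Y) \<partial>M)"
    by (subst nn_integral_distr) (auto intro!: Y.borel_measurable_nn_integral)
  also have "\<dots> = (\<integral>\<^sup>+\<omega>. (\<integral>\<^sup>+\<omega>'. f (X \<omega>, Y \<omega>') \<partial>M) \<partial>M)"
    by (intro nn_integral_cong) (auto simp: nn_integral_distr)
  finally show ?thesis .
qed

lemma distributed_lborel_no_atom:
  fixes X :: "'a \<Rightarrow> real"
  assumes "distributed M lborel X f"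
  shows "AE \<omega> in M. X \<omega> \<noteq> a"
proof -
  have "AE x in lborel. x \<noteq> a" by (rule AE_lborel_singleton)
  then have "AE x in lborel. 0 < f x \<longrightarrow> x \<noteq> a" by eventually_elim simp
  then have "AE x in density lborel f. x \<noteq> a"
    by (subst AE_density) (use distributed_borel_measurable[OF assms] in auto)
  then have "AE x in distr M lborel X. x \<noteq> a"
    unfolding distributed_distr_eq_density[OF assms] .
  then show ?thesis by (rule AE_distrD[OF distributed_measurable[OF assms]])
qed

lemma (in prob_space) integrable_sqrt:
  fixes X :: "'a \<Rightarrow> real"
  assumes X: "integrable M X" and nonneg: "\<And>\<omega>. X \<omega> \<ge> 0"
  shows "integrable M (\<lambda>\<omega>. sqrt (X \<omega>))"
proof (rule Bochner_Integration.integrable_bound[of _ "\<lambda>\<omega>. 1 + X \<omega>"])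
  show "AE \<omega> in M. norm (sqrt (X \<omega>)) \<le> norm (1 + X \<omega>)"
  proof (rule AE_I2)
    fix \<omega>
    have "sqrt (X \<omega>) \<le> 1 + X \<omega>"
      by (rule real_le_lsqrt) (use nonneg[of \<omega>] in \<open>auto simp: power2_eq_square algebra_simps\<close>)
    then show "norm (sqrt (X \<omega>)) \<le> norm (1 + X \<omega>)" using nonneg[of \<omega>] by simp
  qed
qed (use X in auto)

text \<open>Jensen's inequality for the square root, read off from the variance of \<open>sqrt X\<close> being
  nonnegative.\<close>
lemma (in prob_space) expectation_sqrt_le:
  fixes X :: "'a \<Rightarrow> real"
  assumes X: "integrable M X" and nonneg: "\<And>\<omega>. X \<omega> \<ge> 0"
  shows "expectation (\<lambda>\<omega>. sqrt (X \<omega>)) \<le> sqrt (expectation X)"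
proof -
  have "0 \<le> expectation (\<lambda>\<omega>. (sqrt (X \<omega>))\<^sup>2) - (expectation (\<lambda>\<omega>. sqrt (X \<omega>)))\<^sup>2"
    using variance_positive[of "\<lambda>\<omega>. sqrt (X \<omega>)"] variance_eq[OF integrable_sqrt[OF assms]] assms
    by simp
  then show ?thesis using nonneg by (intro real_le_rsqrt) simp
qed

section \<open>The greedy algorithm for a fixed matrix\<close>

text \<open>The vector \<open>H_{:,1:k} xhat_{1:k}\<close> produced by the greedy choice when every tie is resolved
  in favour of \<open>+1\<close>. Unlike the vector built from arbitrarily broken ties, it is a function of the
  first \<open>k\<close> columns alone, which is what independence arguments require. Starting from the zero
  vector, the first step is a tie, so the rule also yields the prescribed first sign \<open>1\<close>.\<close>
fun greedy_vec :: "nat \<Rightarrow> (nat \<Rightarrow> nat \<Rightarrow> real) \<Rightarrow> nat \<Rightarrow> nat \<Rightarrow> real" where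
  "greedy_vec m A 0 i = 0"
| "greedy_vec m A (Suc k) i = greedy_vec m A k i +
     (if (\<Sum>l=1..m. greedy_vec m A k l * A l (Suc k)) \<ge> 0 then 1 else -1) * A i (Suc k)"

definition greedy_corr :: "nat \<Rightarrow> (nat \<Rightarrow> nat \<Rightarrow> real) \<Rightarrow> nat \<Rightarrow> real" where
  "greedy_corr m A k = (\<Sum>i=1..m. greedy_vec m A k i * A i (Suc k))"

definition greedy_energy :: "nat \<Rightarrow> (nat \<Rightarrow> nat \<Rightarrow> real) \<Rightarrow> nat \<Rightarrow> real" where
  "greedy_energy m A k = (\<Sum>i=1..m. (greedy_vec m A k i)\<^sup>2)"

lemma greedy_energy_nonneg: "greedy_energy m A k \<ge> 0"
  by (simp add: greedy_energy_def sum_nonneg)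

lemma sum_square_add_sign:
  fixes v h :: "nat \<Rightarrow> real"
  assumes "s = 1 \<or> s = -1"
  shows "(\<Sum>i\<in>I. (v i + s * h i)\<^sup>2) =
    (\<Sum>i\<in>I. (v i)\<^sup>2) + 2 * s * (\<Sum>i\<in>I. v i * h i) + (\<Sum>i\<in>I. (h i)\<^sup>2)"
proof -
  have "(v i + s * h i)\<^sup>2 = (v i)\<^sup>2 + 2 * s * (v i * h i) + (h i)\<^sup>2" for i
    using assms by (auto simp: power2_eq_square algebra_simps)
  then show ?thesis by (simp add: sum.distrib sum_distrib_left)
qed

text \<open>The greedy sign is the sign of the inner product of the current vector with the new
  column, so the cross term of the squared norm becomes an absolute value.\<close>
lemma greedy_energy_Suc:
  "greedy_energy m A (Suc k) =
     greedy_energy m A k + 2 * \<bar>greedy_corr m A k\<bar> + (\<Sum>i=1..m. (A i (Suc k))\<^sup>2)"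
proof -
  define s :: real where "s = (if greedy_corr m A k \<ge> 0 then 1 else -1)"
  have "s = 1 \<or> s = -1" by (simp add: s_def)
  moreover have "greedy_vec m A (Suc k) i = greedy_vec m A k i + s * A i (Suc k)" for i
    by (simp add: s_def greedy_corr_def)
  moreover have "s * greedy_corr m A k = \<bar>greedy_corr m A k\<bar>" by (simp add: s_def)
  ultimately show ?thesis
    using sum_square_add_sign[of s "greedy_vec m A k" "\<lambda>i. A i (Suc k)" "{1..m}"]
    by (simp add: greedy_energy_def greedy_corr_def del: greedy_vec.simps)
qed

lemma greedy_vec_cong:
  assumes "\<And>i j. i \<in> {1..m} \<Longrightarrow> j \<in> {1..k} \<Longrightarrow> A i j = B i j" "i \<in> {1..m}"
  shows "greedy_vec m A k i = greedy_vec m B k i"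
  using assms
proof (induction k arbitrary: i)
  case (Suc k)
  have IH: "greedy_vec m A k l = greedy_vec m B k l" if "l \<in> {1..m}" for l
    using Suc that by simp
  have "(\<Sum>l=1..m. greedy_vec m A k l * A l (Suc k)) = (\<Sum>l=1..m. greedy_vec m B k l * B l (Suc k))"
    by (intro sum.cong) (use IH Suc.prems(1) in auto)
  moreover have "A i (Suc k) = B i (Suc k)" using Suc.prems by simp
  ultimately show ?case using IH[of i] Suc.prems(2) by simp
qed simp

lemma partial_energy_eq: "partial_energy m A k x = (\<Sum>i=1..m. (\<Sum>j=1..k. A i j * x j)\<^sup>2)"
  by (simp add: partial_energy_def L2_set_def sum_nonneg)

text \<open>With nonzero inner product only one of the two signs maximizes the energy. The first step is
  exempt from the condition because there both sides take the sign \<open>1\<close>.\<close>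
lemma greedy_signs_sum_eq:
  assumes greedy: "greedy_signs m n A x" and k: "k \<le> n"
    and no_tie: "\<And>l. 1 \<le> l \<Longrightarrow> l < n \<Longrightarrow> greedy_corr m A l \<noteq> 0"
  shows "(\<Sum>j=1..k. A i j * x j) = greedy_vec m A k i"
  using k
proof (induction k arbitrary: i)
  case (Suc k)
  have IH: "(\<Sum>j=1..k. A i j * x j) = greedy_vec m A k i" for i using Suc by simp
  define s :: real where "s = (if greedy_corr m A k \<ge> 0 then 1 else -1)"
  have "x (Suc k) = s"
  proof (cases "k = 0")
    case True
    then show ?thesis using greedy by (simp add: greedy_signs_def s_def greedy_corr_def)
  next
    case False
    then have nz: "greedy_corr m A k \<noteq> 0" using no_tie[of k] Suc by simp
    have max: "is_arg_max (\<lambda>t. partial_energy m A (Suc k) (x(Suc k := t))) (\<lambda>t. t \<in> {-1, 1}) (x (Suc k))"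
      using greedy False Suc.prems by (auto simp: greedy_signs_def)
    have en: "partial_energy m A (Suc k) (x(Suc k := t)) =
        greedy_energy m A k + 2 * t * greedy_corr m A k + (\<Sum>i=1..m. (A i (Suc k))\<^sup>2)"
      if "t = 1 \<or> t = -1" for t
    proof -
      have "(\<Sum>j=1..Suc k. A i j * (x(Suc k := t)) j) = greedy_vec m A k i + t * A i (Suc k)" for i
      proof -
        have "(\<Sum>j=1..k. A i j * (x(Suc k := t)) j) = (\<Sum>j=1..k. A i j * x j)"
          by (intro sum.cong) auto
        then show ?thesis using IH[of i] by simp
      qed
      then show ?thesis
        unfolding partial_energy_eq greedy_energy_def greedy_corr_def
        by (simp only: sum_square_add_sign[OF that])
    qed
    have xs: "x (Suc k) = 1 \<or> x (Suc k) = -1" and s: "s = 1 \<or> s = -1"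
      using max by (auto simp: is_arg_max_def s_def)
    have "\<not> partial_energy m A (Suc k) (x(Suc k := s)) > partial_energy m A (Suc k) (x(Suc k := x (Suc k)))"
      using max s unfolding is_arg_max_def by blast
    then have "s * greedy_corr m A k \<le> x (Suc k) * greedy_corr m A k"
      unfolding en[OF xs] en[OF s] by simp
    then show ?thesis using nz xs by (auto simp: s_def split: if_splits)
  qed
  then show ?case using IH[of i] by (simp add: s_def greedy_corr_def)
qed simp

lemma greedy_signs_energy_eq:
  assumes "greedy_signs m n A x" "k \<le> n"
    and "\<And>l. 1 \<le> l \<Longrightarrow> l < n \<Longrightarrow> greedy_corr m A l \<noteq> 0"
  shows "partial_energy m A k x = greedy_energy m A k"
  using greedy_signs_sum_eq[OF assms] by (simp add: partial_energy_eq greedy_energy_def)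

section \<open>Expected energies for a Gaussian matrix\<close>

context prob_space
begin

context
  fixes m n :: nat and H :: "nat \<Rightarrow> nat \<Rightarrow> 'a \<Rightarrow> real"
  assumes H: "std_gaussian_matrix M m n H"
begin

lemma entry_indep: "indep_vars (\<lambda>_. borel) (\<lambda>(i, j). H i j) ({1..m} \<times> {1..n})"
  using H by (simp add: std_gaussian_matrix_def)

lemma entry_normal:
  "i \<in> {1..m} \<Longrightarrow> j \<in> {1..n} \<Longrightarrow> distributed M lborel (H i j) std_normal_density"
  using H by (simp add: std_gaussian_matrix_def)

lemma entry_measurable:
  "i \<in> {1..m} \<Longrightarrow> j \<in> {1..n} \<Longrightarrow> H i j \<in> borel_measurable M"
  using distributed_measurable[OF entry_normal] by simp

lemma entry_second_moment:
  assumes "i \<in> {1..m}" "j \<in> {1..n}"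
  shows "integrable M (\<lambda>\<omega>. (H i j \<omega>)\<^sup>2)" "(\<integral>\<omega>. (H i j \<omega>)\<^sup>2 \<partial>M) = 1"
proof -
  note d = entry_normal[OF assms]
  show "integrable M (\<lambda>\<omega>. (H i j \<omega>)\<^sup>2)"
    using distributed_integrable[OF d, of "\<lambda>x. x\<^sup>2"] integrable_std_normal_moment[of 2] by simp
  show "(\<integral>\<omega>. (H i j \<omega>)\<^sup>2 \<partial>M) = 1"
    using distributed_integral[OF d, of "\<lambda>x. x\<^sup>2"] integral_std_normal_moment_even[of 1]
    by simp
qed

text \<open>Zero weights are discarded before summing, because their terms are not normal variables
  with positive variance.\<close>
lemma linear_combination_normal:
  assumes j: "j \<in> {1..n}" and nz: "(\<Sum>i=1..m. (w i)\<^sup>2) > 0"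
  shows "distributed M lborel (\<lambda>\<omega>. \<Sum>i=1..m. w i * H i j \<omega>)
           (normal_density 0 (sqrt (\<Sum>i=1..m. (w i)\<^sup>2)))"
proof -
  define I where "I = {i\<in>{1..m}. w i \<noteq> 0}"
  have I: "finite I" "I \<noteq> {}" "I \<subseteq> {1..m}"
    using nz by (force simp: I_def intro: ccontr)+
  have ind: "indep_vars (\<lambda>_. borel) (\<lambda>p \<omega>. w (fst p) * (case p of (i, j) \<Rightarrow> H i j) \<omega>) (I \<times> {j})"
    by (rule indep_vars_compose2[OF indep_vars_subset[OF entry_indep]]) (use I j in auto)
  have "distributed M lborel (\<lambda>\<omega>. w i * H i j \<omega>) (normal_density 0 \<bar>w i\<bar>)" if "i \<in> I" for i
    using normal_density_affine[OF entry_normal[of i j], of "w i" 0] that j by (auto simp: I_def)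
  moreover have reindex: "(\<Sum>p\<in>I \<times> {j}. f p) = (\<Sum>i\<in>I. f (i, j))" for f :: "nat \<times> nat \<Rightarrow> real"
    by (rule sum.reindex_bij_witness[of _ "\<lambda>i. (i, j)" fst]) auto
  ultimately have "distributed M lborel (\<lambda>\<omega>. \<Sum>p\<in>I \<times> {j}. w (fst p) * (case p of (i, j) \<Rightarrow> H i j) \<omega>)
      (normal_density (\<Sum>p\<in>I \<times> {j}. 0) (sqrt (\<Sum>p\<in>I \<times> {j}. \<bar>w (fst p)\<bar>\<^sup>2)))"
    using I by (intro sum_indep_normal ind) (auto simp: I_def)
  then have "distributed M lborel (\<lambda>\<omega>. \<Sum>i\<in>I. w i * H i j \<omega>)
      (normal_density 0 (sqrt (\<Sum>i\<in>I. \<bar>w i\<bar>\<^sup>2)))"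
    by (simp add: reindex)
  moreover have "(\<Sum>i\<in>I. w i * H i j \<omega>) = (\<Sum>i=1..m. w i * H i j \<omega>)" for \<omega>
    by (intro sum.mono_neutral_left) (auto simp: I_def)
  moreover have "(\<Sum>i\<in>I. \<bar>w i\<bar>\<^sup>2) = (\<Sum>i=1..m. (w i)\<^sup>2)"
    by (simp, intro sum.mono_neutral_left) (auto simp: I_def)
  ultimately show ?thesis by simp
qed

lemma linear_combination_abs:
  assumes j: "j \<in> {1..n}"
  shows "(\<integral>\<^sup>+\<omega>. ennreal \<bar>\<Sum>i=1..m. w i * H i j \<omega>\<bar> \<partial>M) =
           ennreal (sqrt (2 / pi) * sqrt (\<Sum>i=1..m. (w i)\<^sup>2))"
proof (cases "(\<Sum>i=1..m. (w i)\<^sup>2) > 0")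
  case True
  define \<sigma> where "\<sigma> = sqrt (\<Sum>i=1..m. (w i)\<^sup>2)"
  have \<sigma>: "\<sigma> > 0" using True by (simp add: \<sigma>_def)
  have "(\<integral>\<^sup>+\<omega>. ennreal \<bar>\<Sum>i=1..m. w i * H i j \<omega>\<bar> \<partial>M) =
      (\<integral>\<^sup>+x. ennreal (normal_density 0 \<sigma> x) * ennreal \<bar>x\<bar> \<partial>lborel)"
    using distributed_nn_integral[OF linear_combination_normal[OF j True], of "\<lambda>x. ennreal \<bar>x\<bar>"]
    by (simp add: \<sigma>_def)
  also have "\<dots> = (\<integral>\<^sup>+x. ennreal (normal_density 0 \<sigma> x * \<bar>x\<bar>) \<partial>lborel)"
    by (intro nn_integral_cong) (simp add: ennreal_mult)
  also have "\<dots> = ennreal (sqrt (2 / pi) * \<sigma>)"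
  proof -
    have "has_bochner_integral lborel (\<lambda>x. normal_density 0 \<sigma> x * \<bar>x\<bar>) (sqrt (2 / pi) * \<sigma>)"
      using normal_moment_abs_odd[OF \<sigma>, of 0 0] by (simp add: mult.commute)
    then show ?thesis
      by (intro nn_integral_eq_integrable[THEN iffD2])
         (auto simp: has_bochner_integral_iff \<sigma>_def sum_nonneg)
  qed
  finally show ?thesis by (simp add: \<sigma>_def)
next
  case False
  then have "(\<Sum>i=1..m. (w i)\<^sup>2) = 0"
    using sum_nonneg[of "{1..m}" "\<lambda>i. (w i)\<^sup>2"] by simp
  then have "\<forall>i\<in>{1..m}. w i = 0" by (simp add: sum_nonneg_eq_0_iff)
  then show ?thesis by simp
qed

lemma linear_combination_nonzero:
  assumes j: "j \<in> {1..n}" and nz: "(\<Sum>i=1..m. (w i)\<^sup>2) > 0"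
  shows "AE \<omega> in M. (\<Sum>i=1..m. w i * H i j \<omega>) \<noteq> 0"
  using distributed_lborel_no_atom[OF linear_combination_normal[OF assms]] .

text \<open>The vector after \<open>k\<close> steps is a measurable function of the first \<open>k\<close> columns, a block of
  entries disjoint from the next column.\<close>
lemma greedy_vec_indep_column:
  assumes k: "k < n"
  shows "indep_var (PiM {1..m} (\<lambda>_. borel)) (\<lambda>\<omega>. \<lambda>i\<in>{1..m}. greedy_vec m (\<lambda>i j. H i j \<omega>) k i)
                   (PiM {1..m} (\<lambda>_. borel)) (\<lambda>\<omega>. \<lambda>i\<in>{1..m}. H i (Suc k) \<omega>)"
proof -
  let ?A = "{1..m} \<times> {1..k}" and ?B = "{1..m} \<times> {Suc k}"
  have ind: "indep_var (PiM ?A (\<lambda>_. borel)) (\<lambda>\<omega>. \<lambda>p\<in>?A. (\<lambda>(i, j). H i j) p \<omega>)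
                 (PiM ?B (\<lambda>_. borel)) (\<lambda>\<omega>. \<lambda>p\<in>?B. (\<lambda>(i, j). H i j) p \<omega>)"
    by (rule indep_var_restrict[OF entry_indep]) (use k in auto)
  let ?F = "\<lambda>a. \<lambda>i\<in>{1..m}. greedy_vec m (\<lambda>i j. a (i, j)) k i"
  let ?G = "\<lambda>b. \<lambda>i\<in>{1..m}. b (i, Suc k)"
  have meas: "(\<lambda>a. greedy_vec m (\<lambda>i j. a (i, j)) l i) \<in> borel_measurable (PiM ?A (\<lambda>_. borel :: real measure))"
    if "l \<le> k" "i \<in> {1..m}" for l i
    using that
  proof (induction l arbitrary: i)
    case (Suc l)
    have [measurable]: "(\<lambda>a. a (i, Suc l)) \<in> borel_measurable (PiM ?A (\<lambda>_. borel :: real measure))"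
      if "i \<in> {1..m}" for i
      by (rule measurable_component_singleton) (use that Suc.prems in auto)
    have [measurable]: "(\<lambda>a. greedy_vec m (\<lambda>i j. a (i, j)) l i) \<in> borel_measurable (PiM ?A (\<lambda>_. borel :: real measure))"
      if "i \<in> {1..m}" for i
      using Suc that by simp
    note [measurable] = this[OF Suc.prems(2)]
    have [measurable]: "(\<lambda>a. \<Sum>i=1..m. greedy_vec m (\<lambda>i j. a (i, j)) l i * a (i, Suc l))
        \<in> borel_measurable (PiM ?A (\<lambda>_. borel :: real measure))"
      by (intro borel_measurable_sum) measurable
    have [measurable]: "(\<lambda>a. a (i, Suc l)) \<in> borel_measurable (PiM ?A (\<lambda>_. borel :: real measure))"
      by (rule measurable_component_singleton) (use Suc.prems in auto)
    show ?case unfolding greedy_vec.simps by measurable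
  qed simp
  have F: "?F \<in> measurable (PiM ?A (\<lambda>_. borel)) (PiM {1..m} (\<lambda>_. borel))"
    by (intro measurable_restrict meas) auto
  have G: "?G \<in> measurable (PiM ?B (\<lambda>_. borel)) (PiM {1..m} (\<lambda>_. borel))"
    by (intro measurable_restrict measurable_component_singleton) auto
  have "?F \<circ> (\<lambda>\<omega>. \<lambda>p\<in>?A. (\<lambda>(i, j). H i j) p \<omega>) =
      (\<lambda>\<omega>. \<lambda>i\<in>{1..m}. greedy_vec m (\<lambda>i j. H i j \<omega>) k i)"
    by (auto simp: fun_eq_iff restrict_def intro!: greedy_vec_cong)
  moreover have "?G \<circ> (\<lambda>\<omega>. \<lambda>p\<in>?B. (\<lambda>(i, j). H i j) p \<omega>) = (\<lambda>\<omega>. \<lambda>i\<in>{1..m}. H i (Suc k) \<omega>)"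
    by (auto simp: fun_eq_iff restrict_def)
  ultimately show ?thesis using indep_var_compose[OF ind F G] by simp
qed

lemma greedy_vec_measurable:
  assumes "k \<le> n" "i \<in> {1..m}"
  shows "(\<lambda>\<omega>. greedy_vec m (\<lambda>i j. H i j \<omega>) k i) \<in> borel_measurable M"
  using assms
proof (induction k arbitrary: i)
  case (Suc k)
  have [measurable]: "H i (Suc k) \<in> borel_measurable M" if "i \<in> {1..m}" for i
    using that Suc.prems by (intro entry_measurable) auto
  have [measurable]: "(\<lambda>\<omega>. greedy_vec m (\<lambda>i j. H i j \<omega>) k i) \<in> borel_measurable M"
    if "i \<in> {1..m}" for i
    using Suc that by simp
  note [measurable] = this[OF Suc.prems(2)]
  have [measurable]: "(\<lambda>\<omega>. \<Sum>i=1..m. greedy_vec m (\<lambda>i j. H i j \<omega>) k i * H i (Suc k) \<omega>) \<in> borel_measurable M"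
    by (intro borel_measurable_sum) measurable
  have [measurable]: "H i (Suc k) \<in> borel_measurable M"
    using Suc.prems by (intro entry_measurable) auto
  show ?case unfolding greedy_vec.simps by measurable
qed simp

lemma greedy_energy_measurable:
  "k \<le> n \<Longrightarrow> (\<lambda>\<omega>. greedy_energy m (\<lambda>i j. H i j \<omega>) k) \<in> borel_measurable M"
  unfolding greedy_energy_def
  by (intro borel_measurable_sum borel_measurable_power greedy_vec_measurable) auto

lemma greedy_corr_measurable:
  "k < n \<Longrightarrow> (\<lambda>\<omega>. greedy_corr m (\<lambda>i j. H i j \<omega>) k) \<in> borel_measurable M"
  unfolding greedy_corr_def
  by (intro borel_measurable_sum borel_measurable_times greedy_vec_measurable entry_measurable) auto

lemma nn_integral_greedy_corr:
  assumes k: "k < n" and [measurable]: "f \<in> borel_measurable borel"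
  shows "(\<integral>\<^sup>+\<omega>. f (greedy_corr m (\<lambda>i j. H i j \<omega>) k) \<partial>M) =
    (\<integral>\<^sup>+\<omega>. (\<integral>\<^sup>+\<omega>'. f (\<Sum>i=1..m. greedy_vec m (\<lambda>i j. H i j \<omega>) k i * H i (Suc k) \<omega>') \<partial>M) \<partial>M)"
proof -
  have [measurable]: "(\<lambda>p. f (\<Sum>i=1..m. fst p i * snd p i)) \<in>
      borel_measurable (PiM {1..m} (\<lambda>_. borel :: real measure) \<Otimes>\<^sub>M PiM {1..m} (\<lambda>_. borel))"
    by measurable
  show ?thesis
    using nn_integral_indep_var[OF greedy_vec_indep_column[OF k], of "\<lambda>p. f (\<Sum>i=1..m. fst p i * snd p i)"]
    by (simp add: greedy_corr_def)
qed

text \<open>Each step adds at least the squared norm of the new column, in particular the square of its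
  first entry, which has no atom at 0.\<close>
lemma greedy_energy_pos:
  assumes m: "m > 0" and k: "1 \<le> k" "k \<le> n"
  shows "AE \<omega> in M. greedy_energy m (\<lambda>i j. H i j \<omega>) k > 0"
proof -
  obtain l where l: "k = Suc l" using k by (cases k) auto
  have "AE \<omega> in M. H 1 k \<omega> \<noteq> 0"
    by (rule distributed_lborel_no_atom[OF entry_normal]) (use m k in auto)
  then show ?thesis
  proof eventually_elim
    case (elim \<omega>)
    have "0 < (H 1 k \<omega>)\<^sup>2" using elim by simp
    also have "\<dots> \<le> (\<Sum>i=1..m. (H i k \<omega>)\<^sup>2)"
      by (rule member_le_sum) (use m in auto)
    also have "\<dots> \<le> greedy_energy m (\<lambda>i j. H i j \<omega>) k"
      using greedy_energy_nonneg[of m "\<lambda>i j. H i j \<omega>" l] by (simp add: l greedy_energy_Suc)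
    finally show ?case .
  qed
qed

text \<open>Given the current vector, the inner product with the next column is a nondegenerate centred
  normal variable, hence almost surely nonzero: ties have probability zero.\<close>
lemma greedy_corr_nonzero:
  assumes m: "m > 0" and k: "1 \<le> k" "k < n"
  shows "AE \<omega> in M. greedy_corr m (\<lambda>i j. H i j \<omega>) k \<noteq> 0"
proof -
  note [measurable] = greedy_corr_measurable[OF k(2)]
  have "(\<integral>\<^sup>+\<omega>. indicator {0} (greedy_corr m (\<lambda>i j. H i j \<omega>) k) \<partial>M) =
    (\<integral>\<^sup>+\<omega>. (\<integral>\<^sup>+\<omega>'. indicator {0} (\<Sum>i=1..m. greedy_vec m (\<lambda>i j. H i j \<omega>) k i * H i (Suc k) \<omega>') \<partial>M) \<partial>M)"
    by (rule nn_integral_greedy_corr[OF k(2)]) simp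
  also have "\<dots> = (\<integral>\<^sup>+\<omega>. 0 \<partial>M)"
  proof (rule nn_integral_cong_AE)
    show "AE \<omega> in M. (\<integral>\<^sup>+\<omega>'. indicator {0} (\<Sum>i=1..m. greedy_vec m (\<lambda>i j. H i j \<omega>) k i * H i (Suc k) \<omega>') \<partial>M) = 0"
      using greedy_energy_pos[OF m k(1) less_imp_le[OF k(2)]]
    proof eventually_elim
      case (elim \<omega>)
      have "AE \<omega>' in M. (\<Sum>i=1..m. greedy_vec m (\<lambda>i j. H i j \<omega>) k i * H i (Suc k) \<omega>') \<noteq> 0"
        using linear_combination_nonzero[of "Suc k" "greedy_vec m (\<lambda>i j. H i j \<omega>) k"] elim k
        by (simp add: greedy_energy_def)
      then have "AE \<omega>' in M. indicator {0} (\<Sum>i=1..m. greedy_vec m (\<lambda>i j. H i j \<omega>) k i * H i (Suc k) \<omega>') = (0::ennreal)"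
        by eventually_elim simp
      then show ?case using nn_integral_cong_AE by fastforce
    qed
  qed
  finally have "(\<integral>\<^sup>+\<omega>. indicator {0} (greedy_corr m (\<lambda>i j. H i j \<omega>) k) \<partial>M) = 0" by simp
  then have "AE \<omega> in M. indicator {0} (greedy_corr m (\<lambda>i j. H i j \<omega>) k) = (0::ennreal)"
    by (subst (asm) nn_integral_0_iff_AE) auto
  then show ?thesis by eventually_elim (auto simp: indicator_def split: if_splits)
qed

text \<open>Given the current vector, the inner product is normal with standard deviation equal to the
  norm of that vector, and the mean absolute value of a centred normal variable is
  \<open>sqrt (2 / pi)\<close> times its standard deviation.\<close>
lemma greedy_corr_abs:
  assumes k: "k < n" and int: "integrable M (\<lambda>\<omega>. greedy_energy m (\<lambda>i j. H i j \<omega>) k)"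
  shows "integrable M (\<lambda>\<omega>. \<bar>greedy_corr m (\<lambda>i j. H i j \<omega>) k\<bar>)" (is "integrable M ?c")
    and "expectation (\<lambda>\<omega>. \<bar>greedy_corr m (\<lambda>i j. H i j \<omega>) k\<bar>) =
      sqrt (2 / pi) * expectation (\<lambda>\<omega>. sqrt (greedy_energy m (\<lambda>i j. H i j \<omega>) k))"
proof -
  note [measurable] = greedy_corr_measurable[OF k]
  let ?e = "\<lambda>\<omega>. sqrt (greedy_energy m (\<lambda>i j. H i j \<omega>) k)"
  have inte: "integrable M ?e" by (rule integrable_sqrt[OF int greedy_energy_nonneg])
  have "(\<integral>\<^sup>+\<omega>. ennreal (?c \<omega>) \<partial>M) = (\<integral>\<^sup>+\<omega>. ennreal (sqrt (2 / pi) * ?e \<omega>) \<partial>M)"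
    using nn_integral_greedy_corr[OF k, of "\<lambda>x. ennreal \<bar>x\<bar>"] k
    by (simp add: linear_combination_abs greedy_energy_def del: One_nat_def)
  also have "\<dots> = ennreal (sqrt (2 / pi) * expectation ?e)"
    using inte by (subst nn_integral_eq_integral) (auto simp: greedy_energy_nonneg)
  finally have nn: "(\<integral>\<^sup>+\<omega>. ennreal (?c \<omega>) \<partial>M) = ennreal (sqrt (2 / pi) * expectation ?e)" .
  have "0 \<le> sqrt (2 / pi) * expectation ?e"
    by (intro mult_nonneg_nonneg integral_nonneg_AE) (auto simp: greedy_energy_nonneg)
  then show "integrable M ?c" "expectation ?c = sqrt (2 / pi) * expectation ?e"
    using nn nn_integral_eq_integrable[of ?c M "sqrt (2 / pi) * expectation ?e"] by auto
qed

lemma greedy_energy_expectation_Suc: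
  assumes k: "k < n" and int: "integrable M (\<lambda>\<omega>. greedy_energy m (\<lambda>i j. H i j \<omega>) k)"
  shows "integrable M (\<lambda>\<omega>. greedy_energy m (\<lambda>i j. H i j \<omega>) (Suc k))"
    and "expectation (\<lambda>\<omega>. greedy_energy m (\<lambda>i j. H i j \<omega>) (Suc k)) =
      expectation (\<lambda>\<omega>. greedy_energy m (\<lambda>i j. H i j \<omega>) k) +
      2 * sqrt (2 / pi) * expectation (\<lambda>\<omega>. sqrt (greedy_energy m (\<lambda>i j. H i j \<omega>) k)) + real m"
proof -
  note corr = greedy_corr_abs[OF assms]
  have col: "integrable M (\<lambda>\<omega>. (H i (Suc k) \<omega>)\<^sup>2)" "expectation (\<lambda>\<omega>. (H i (Suc k) \<omega>)\<^sup>2) = 1"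
    if "i \<in> {1..m}" for i
    using entry_second_moment[OF that, of "Suc k"] k by auto
  have colsum: "integrable M (\<lambda>\<omega>. \<Sum>i=1..m. (H i (Suc k) \<omega>)\<^sup>2)"
    using col by (intro Bochner_Integration.integrable_sum) auto
  show "integrable M (\<lambda>\<omega>. greedy_energy m (\<lambda>i j. H i j \<omega>) (Suc k))"
    unfolding greedy_energy_Suc
    by (intro Bochner_Integration.integrable_add integrable_mult_right int corr colsum)
  have "expectation (\<lambda>\<omega>. \<Sum>i=1..m. (H i (Suc k) \<omega>)\<^sup>2) = real m"
    using col by (subst Bochner_Integration.integral_sum) auto
  then show "expectation (\<lambda>\<omega>. greedy_energy m (\<lambda>i j. H i j \<omega>) (Suc k)) =
      expectation (\<lambda>\<omega>. greedy_energy m (\<lambda>i j. H i j \<omega>) k) +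
      2 * sqrt (2 / pi) * expectation (\<lambda>\<omega>. sqrt (greedy_energy m (\<lambda>i j. H i j \<omega>) k)) + real m"
    unfolding greedy_energy_Suc using int corr colsum by simp
qed

lemma greedy_energy_integrable:
  "k \<le> n \<Longrightarrow> integrable M (\<lambda>\<omega>. greedy_energy m (\<lambda>i j. H i j \<omega>) k)"
proof (induction k)
  case 0
  then show ?case by (simp add: greedy_energy_def)
qed (simp add: greedy_energy_expectation_Suc)

text \<open>The given signs may break ties in any way, even depending on later columns. This is
  harmless because ties almost surely do not occur, and without ties the argmax is unique.\<close>
lemma greedy_value_AE_eq:
  assumes m: "m > 0" and k: "k \<le> n"
    and greedy: "\<And>\<omega>. \<omega> \<in> space M \<Longrightarrow> greedy_signs m n (\<lambda>i j. H i j \<omega>) (\<lambda>k. x k \<omega>)"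
  shows "AE \<omega> in M. greedy_value m H x k \<omega> = greedy_energy m (\<lambda>i j. H i j \<omega>) k"
proof -
  have "AE \<omega> in M. \<forall>l\<in>{1..<n}. greedy_corr m (\<lambda>i j. H i j \<omega>) l \<noteq> 0"
    by (subst AE_ball_countable) (auto intro!: greedy_corr_nonzero[OF m])
  then show ?thesis
  proof (rule AE_mp, intro AE_I2 impI)
    fix \<omega> assume "\<omega> \<in> space M" "\<forall>l\<in>{1..<n}. greedy_corr m (\<lambda>i j. H i j \<omega>) l \<noteq> 0"
    then show "greedy_value m H x k \<omega> = greedy_energy m (\<lambda>i j. H i j \<omega>) k"
      unfolding greedy_value_def by (intro greedy_signs_energy_eq[OF greedy k]) auto
  qed
qed

lemma expectation_greedy_value:
  fixes f :: "real \<Rightarrow> real"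
  assumes m: "m > 0" and k: "k \<le> n"
    and x: "\<And>k. k \<in> {1..n} \<Longrightarrow> x k \<in> borel_measurable M"
    and greedy: "\<And>\<omega>. \<omega> \<in> space M \<Longrightarrow> greedy_signs m n (\<lambda>i j. H i j \<omega>) (\<lambda>k. x k \<omega>)"
    and [measurable]: "f \<in> borel_measurable borel"
  shows "expectation (\<lambda>\<omega>. f (greedy_value m H x k \<omega>)) =
         expectation (\<lambda>\<omega>. f (greedy_energy m (\<lambda>i j. H i j \<omega>) k))"
proof (rule integral_cong_AE)
  note [measurable] = greedy_energy_measurable[OF k]
  have [measurable]: "greedy_value m H x k \<in> borel_measurable M"
    unfolding greedy_value_def partial_energy_eq
    by (intro borel_measurable_sum borel_measurable_power borel_measurable_times entry_measurable x)
       (use k in auto)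
  show "(\<lambda>\<omega>. f (greedy_value m H x k \<omega>)) \<in> borel_measurable M"
    and "(\<lambda>\<omega>. f (greedy_energy m (\<lambda>i j. H i j \<omega>) k)) \<in> borel_measurable M"
    by measurable
  show "AE \<omega> in M. f (greedy_value m H x k \<omega>) = f (greedy_energy m (\<lambda>i j. H i j \<omega>) k)"
  proof -
    have "AE \<omega> in M. greedy_value m H x k \<omega> = greedy_energy m (\<lambda>i j. H i j \<omega>) k"
      by (rule greedy_value_AE_eq[OF m k]) (rule greedy)
    then show ?thesis by eventually_elim simp
  qed
qed

lemma greedy_value_moments:
  assumes m: "m > 0"
    and x: "\<And>k. k \<in> {1..n} \<Longrightarrow> x k \<in> borel_measurable M"
    and greedy: "\<And>\<omega>. \<omega> \<in> space M \<Longrightarrow> greedy_signs m n (\<lambda>i j. H i j \<omega>) (\<lambda>k. x k \<omega>)"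
  shows "k < n \<Longrightarrow> expectation (greedy_value m H x (Suc k)) =
      expectation (greedy_value m H x k) +
      2 * sqrt (2 / pi) * expectation (\<lambda>\<omega>. sqrt (greedy_value m H x k \<omega>)) + real m"
    and "k \<le> n \<Longrightarrow> expectation (\<lambda>\<omega>. sqrt (greedy_value m H x k \<omega>)) \<le> sqrt (expectation (greedy_value m H x k))"
proof -
  have id: "expectation (greedy_value m H x k) = expectation (\<lambda>\<omega>. greedy_energy m (\<lambda>i j. H i j \<omega>) k)"
    and sqrt: "expectation (\<lambda>\<omega>. sqrt (greedy_value m H x k \<omega>)) =
      expectation (\<lambda>\<omega>. sqrt (greedy_energy m (\<lambda>i j. H i j \<omega>) k))" if "k \<le> n" for k
    by (rule expectation_greedy_value[where f = "\<lambda>x. x", OF m that x greedy]; simp)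
       (rule expectation_greedy_value[where f = sqrt, OF m that x greedy]; simp)
  show "expectation (greedy_value m H x (Suc k)) =
      expectation (greedy_value m H x k) +
      2 * sqrt (2 / pi) * expectation (\<lambda>\<omega>. sqrt (greedy_value m H x k \<omega>)) + real m" if "k < n"
    using greedy_energy_expectation_Suc(2)[OF that greedy_energy_integrable] that
    by (simp add: id sqrt)
  show "expectation (\<lambda>\<omega>. sqrt (greedy_value m H x k \<omega>)) \<le> sqrt (expectation (greedy_value m H x k))"
    if "k \<le> n"
    using expectation_sqrt_le[OF greedy_energy_integrable[OF that] greedy_energy_nonneg]
    by (simp add: id[OF that] sqrt[OF that])
qed

end
end

section \<open>Proof of the theorem\<close>

lemma phi_Suc: "phi m (Suc k) = phi m k + 2 * sqrt (2 / pi) * sqrt (phi m k) + real m"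
  by (cases k) auto

lemma phi_nonneg: "phi m k \<ge> 0"
  by (induction k) (auto simp: phi_Suc)

theorem mainTheorem5:
  fixes \<alpha> :: real
    and M :: "nat \<Rightarrow> 'a measure"
    and H :: "nat \<Rightarrow> nat \<Rightarrow> nat \<Rightarrow> 'a \<Rightarrow> real"
    and xhat :: "nat \<Rightarrow> nat \<Rightarrow> 'a \<Rightarrow> real"
    and m :: "nat \<Rightarrow> nat"
    and r :: "nat \<Rightarrow> nat \<Rightarrow> 'a \<Rightarrow> real"
  defines "m \<equiv> num_rows \<alpha>"
    and "r \<equiv> \<lambda>n. greedy_value (m n) (H n) (xhat n)"
  assumes alpha: "\<alpha> > 0"
    and prob: "\<And>n. n \<in> admissible \<alpha> \<Longrightarrow> prob_space (M n)"
    and gaussian: "\<And>n. n \<in> admissible \<alpha> \<Longrightarrow> std_gaussian_matrix (M n) (m n) n (H n)"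
    and measurable: "\<And>n k. n \<in> admissible \<alpha> \<Longrightarrow> k \<in> {1..n} \<Longrightarrow> xhat n k \<in> borel_measurable (M n)"
    and greedy: "\<And>n \<omega>. n \<in> admissible \<alpha> \<Longrightarrow> \<omega> \<in> space (M n) \<Longrightarrow>
        greedy_signs (m n) n (\<lambda>i j. H n i j \<omega>) (\<lambda>k. xhat n k \<omega>)"
  shows "(\<forall>n\<in>admissible \<alpha>. \<forall>k\<in>{2..n}.
            (\<integral>\<omega>. r n k \<omega> \<partial>M n) =
              (\<integral>\<omega>. r n (k - 1) \<omega> \<partial>M n)
                + 2 * sqrt (2 / pi) * (\<integral>\<omega>. sqrt (r n (k - 1) \<omega>) \<partial>M n) + real (m n))
       \<and> ((\<forall>c\<in>{0<..1::real}.
             ((\<lambda>n. let k = nat \<lceil>c * real n\<rceil> in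
                 (\<integral>\<omega>. sqrt (r n k \<omega>) \<partial>M n) / real n - sqrt (\<integral>\<omega>. r n k \<omega> \<partial>M n) / real n)
               \<longlongrightarrow> 0) (admissible_at_top \<alpha>))
          \<longrightarrow> (\<exists>L::real.
                ((\<lambda>n. (\<integral>\<omega>. r n n \<omega> \<partial>M n) / (real n)\<^sup>2) \<longlongrightarrow> L) (admissible_at_top \<alpha>) \<and>
                ((\<lambda>n. phi (m n) n / (real n)\<^sup>2) \<longlongrightarrow> L) (admissible_at_top \<alpha>)))"
proof (intro conjI impI)
  \<comment> \<open>The empty partial sum has energy 0 and \<open>phi m 0 = 0\<close>, so both recursions can be started at
    index 0, where the differential equation has its initial value.\<close>
  define c where "c = sqrt (2 / pi)"
  define e where "e n k = (\<integral>\<omega>. r n k \<omega> \<partial>M n)" for n k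
  define q where "q n k = (\<integral>\<omega>. sqrt (r n k \<omega>) \<partial>M n)" for n k
  have c: "c > 0" by (simp add: c_def)
  have n_pos: "n > 0" and rows: "real (m n) = \<alpha> * real n" if n: "n \<in> admissible \<alpha>" for n
  proof -
    obtain j :: nat where j: "0 < j" "real j = \<alpha> * real n"
      using n unfolding admissible_def by blast
    show "real (m n) = \<alpha> * real n"
      unfolding m_def num_rows_def j(2)[symmetric] by simp
    show "n > 0" using j by (cases "n = 0") simp_all
  qed
  have m_pos: "m n > 0" if "n \<in> admissible \<alpha>" for n
    using rows[OF that] n_pos[OF that] alpha by (metis mult_pos_pos of_nat_0_less_iff)
  have rec: "e n (Suc k) = e n k + 2 * c * q n k + real (m n)" if "n \<in> admissible \<alpha>" "k < n" for n k
    using prob_space.greedy_value_moments(1)[of "M n" "m n" n "H n" "xhat n" k]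
      prob gaussian measurable greedy m_pos that
    by (simp add: e_def q_def r_def c_def)
  have jensen: "q n k \<le> sqrt (e n k)" if "n \<in> admissible \<alpha>" "k \<le> n" for n k
    using prob_space.greedy_value_moments(2)[of "M n" "m n" n "H n" "xhat n" k]
      prob gaussian measurable greedy m_pos that
    by (simp add: e_def q_def r_def)
  have r_nonneg: "r n k \<omega> \<ge> 0" for n k \<omega>
    by (simp add: r_def greedy_value_def partial_energy_def)
  have q_nonneg: "q n k \<ge> 0" for n k
    by (simp add: q_def r_nonneg)
  have r_0: "r n 0 \<omega> = 0" for n \<omega>
    by (simp add: r_def greedy_value_def partial_energy_eq)
  have e_0: "e n 0 = 0" and q_0: "q n 0 = 0" for n
    by (simp_all add: e_def q_def r_0)

  show "\<forall>n\<in>admissible \<alpha>. \<forall>k\<in>{2..n}.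
            (\<integral>\<omega>. r n k \<omega> \<partial>M n) =
              (\<integral>\<omega>. r n (k - 1) \<omega> \<partial>M n)
                + 2 * sqrt (2 / pi) * (\<integral>\<omega>. sqrt (r n (k - 1) \<omega>) \<partial>M n) + real (m n)"
  proof (intro ballI)
    fix n k assume "n \<in> admissible \<alpha>" "k \<in> {2..n}"
    then show "(\<integral>\<omega>. r n k \<omega> \<partial>M n) =
              (\<integral>\<omega>. r n (k - 1) \<omega> \<partial>M n)
                + 2 * sqrt (2 / pi) * (\<integral>\<omega>. sqrt (r n (k - 1) \<omega>) \<partial>M n) + real (m n)"
      using rec[of n "k - 1"] by (cases k) (simp_all add: e_def q_def c_def)
  qed

  assume conc: "\<forall>c\<in>{0<..1::real}.
             ((\<lambda>n. let k = nat \<lceil>c * real n\<rceil> in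
                 (\<integral>\<omega>. sqrt (r n k \<omega>) \<partial>M n) / real n - sqrt (\<integral>\<omega>. r n k \<omega> \<partial>M n) / real n)
               \<longlongrightarrow> 0) (admissible_at_top \<alpha>)"
  let ?F = "admissible_at_top \<alpha>"
  have F: "?F \<le> sequentially" by (simp add: admissible_at_top_def)
  have evI: "eventually P ?F" if "\<And>n. n \<in> admissible \<alpha> \<Longrightarrow> P n" for P
    using that by (simp add: admissible_at_top_def eventually_inf_principal)
  obtain L where L: "L \<ge> 0" "travel_time c \<alpha> L = 1"
    using travel_time_eq_1[OF c alpha] by auto

  define g where "g n k = e n k / (real n)\<^sup>2" for n k
  define s where "s n k = q n k / real n" for n k
  have sqrt_g: "sqrt (g n k) = sqrt (e n k) / real n" for n k
    by (simp add: g_def real_sqrt_divide)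
  have s: "0 \<le> s n k \<and> s n k \<le> sqrt (g n k)" if "n \<in> admissible \<alpha>" "k \<le> n" for n k
    using jensen[OF that] by (simp add: s_def sqrt_g q_nonneg divide_right_mono)
  have step: "g n (Suc k) = g n k + 1 / real n * (2 * c * s n k + \<alpha>)"
    if "n \<in> admissible \<alpha>" "k < n" for n k
    using n_pos[OF that(1)] rows[OF that(1)]
    by (simp add: g_def s_def rec[OF that] field_simps power2_eq_square)
  \<comment> \<open>A bound uniform in \<open>n\<close> and \<open>k\<close>, which serves as the dominating constant below.\<close>
  have g_le: "g n k \<le> L" if "n \<in> admissible \<alpha>" "k \<le> n" for n k
  proof -
    have "travel_time c \<alpha> (g n k) \<le> 1 / real n * real k"
      using perturbed_euler_bounds[OF c alpha, of "1 / real n" "g n" n "s n" k] step s that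
      by (simp add: g_def e_0)
    also have "\<dots> \<le> 1" using that n_pos[OF that(1)] by simp
    finally show ?thesis
      using travel_time_strict_mono[OF c alpha L(1), of "g n k"] L by (smt (verit))
  qed
  have "((\<lambda>n. g n n) \<longlongrightarrow> L) ?F"
  proof (rule perturbed_euler_tendsto[OF c alpha F L, where g = g and s = s])
    define \<delta> where "\<delta> n k = sqrt (g n k) - s n k" for n k
    have \<delta>_nonneg: "\<delta> n k \<ge> 0" if "n \<in> admissible \<alpha>" "k \<le> n" for n k
      using s[OF that] by (simp add: \<delta>_def)
    have "((\<lambda>n. (\<Sum>k=1..n. \<delta> n k) / real n) \<longlongrightarrow> 0) ?F"
      unfolding admissible_at_top_def
    proof (rule ceiling_average_tendsto_0[where B = "sqrt L"])
      fix n k :: nat assume nk: "n \<in> admissible \<alpha>" "k \<in> {1..n}"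
      have "sqrt (g n k) \<le> sqrt L" using g_le[of n k] nk by simp
      moreover have "0 \<le> s n k" "s n k \<le> sqrt (g n k)" using s[of n k] nk by auto
      ultimately show "\<bar>\<delta> n k\<bar> \<le> sqrt L" unfolding \<delta>_def by linarith
    next
      fix t :: real assume "0 < t" "t \<le> 1"
      then have "((\<lambda>n. - (s n (nat \<lceil>t * real n\<rceil>) - sqrt (g n (nat \<lceil>t * real n\<rceil>)))) \<longlongrightarrow> - 0) ?F"
        using conc by (intro tendsto_minus) (simp add: s_def sqrt_g e_def q_def Let_def)
      then show "((\<lambda>n. \<delta> n (nat \<lceil>t * real n\<rceil>)) \<longlongrightarrow> 0) (inf sequentially (principal (admissible \<alpha>)))"
        by (simp add: \<delta>_def admissible_at_top_def)
    qed (use L in simp)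
    moreover have "eventually (\<lambda>n. 0 \<le> (\<Sum>k<n. \<delta> n k) / real n) ?F"
      by (rule evI) (auto intro!: divide_nonneg_nonneg sum_nonneg \<delta>_nonneg)
    moreover have "eventually (\<lambda>n. (\<Sum>k<n. \<delta> n k) / real n \<le> (\<Sum>k=1..n. \<delta> n k) / real n) ?F"
    proof (rule evI)
      fix n assume n: "n \<in> admissible \<alpha>"
      have "(\<Sum>k<n. \<delta> n k) = (\<Sum>k\<in>{1..<n}. \<delta> n k)"
        by (rule sum.mono_neutral_right) (auto simp: \<delta>_def s_def g_def e_0 q_0 Suc_le_eq)
      also have "\<dots> \<le> (\<Sum>k=1..n. \<delta> n k)"
        by (rule sum_mono2) (auto intro: \<delta>_nonneg n)
      finally show "(\<Sum>k<n. \<delta> n k) / real n \<le> (\<Sum>k=1..n. \<delta> n k) / real n"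
        by (rule divide_right_mono) simp
    qed
    ultimately show "((\<lambda>n. (\<Sum>k<n. sqrt (g n k) - s n k) / real n) \<longlongrightarrow> 0) ?F"
      unfolding \<delta>_def[symmetric] by (rule real_tendsto_sandwich[rotated 2, OF tendsto_const])
  qed (use step s in \<open>auto intro!: evI simp: e_0 g_def[of _ 0]\<close>)
  \<comment> \<open>For \<open>phi\<close> the Euler scheme is unperturbed: the error sum vanishes identically.\<close>
  moreover have "((\<lambda>n. phi (m n) n / (real n)\<^sup>2) \<longlongrightarrow> L) ?F"
  proof (rule perturbed_euler_tendsto[OF c alpha F L, where
      g = "\<lambda>n k. phi (m n) k / (real n)\<^sup>2" and s = "\<lambda>n k. sqrt (phi (m n) k) / real n"])
    show "eventually (\<lambda>n. \<forall>k<n. phi (m n) (Suc k) / (real n)\<^sup>2 =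
        phi (m n) k / (real n)\<^sup>2 + 1 / real n * (2 * c * (sqrt (phi (m n) k) / real n) + \<alpha>)) ?F"
    proof (intro evI allI impI)
      fix n k assume n: "n \<in> admissible \<alpha>"
      show "phi (m n) (Suc k) / (real n)\<^sup>2 =
        phi (m n) k / (real n)\<^sup>2 + 1 / real n * (2 * c * (sqrt (phi (m n) k) / real n) + \<alpha>)"
        using n_pos[OF n] rows[OF n]
        by (simp add: phi_Suc c_def[symmetric] field_simps power2_eq_square)
    qed
  qed (auto simp: real_sqrt_divide phi_nonneg)
  ultimately show "\<exists>L::real.
                ((\<lambda>n. (\<integral>\<omega>. r n n \<omega> \<partial>M n) / (real n)\<^sup>2) \<longlongrightarrow> L) ?F \<and>
                ((\<lambda>n. phi (m n) n / (real n)\<^sup>2) \<longlongrightarrow> L) ?F"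
    by (auto simp: g_def e_def)
qed

end
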